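(* Let $G$ be a second-countable locally compact amenable unimodular group and let $(\pi,\mathcal{H}_\pi)$ be an irreducible, square-integrable projective unitary representation of $G$. Let $\Lambda \subseteq G$ be relatively dense and $g \in \mathcal{H}_{\pi}$. Suppose that $\pi(\Lambda)g$ is complete. Then $\pi(\Lambda^2)g$ satisfies the homogeneous approximation property.
   Context: A set $\Lambda\subseteq G$ is relatively dense if there is a compact $K\subseteq G$ with $\Lambda K = G$. Write $\Lambda^2 = \{\lambda\lambda' : \lambda,\lambda'\in\Lambda\}$. A projective unitary representation of $G$ is a strongly continuous map $\pi: G \to \mathcal{U}(\mathcal{H}_\pi)$ into the unitary operators on a Hilbert space with $\pi(x)\pi(y) = \sigma(x,y)\pi(xy)$ for all $x,y\in G$, for some (2-cocycle) $\sigma: G\times G \to \mathbb{T}$. It is irreducible if $\{0\}$ and $\mathcal{H}_\pi$ are the only closed $\pi(G)$-invariant subspaces. An irreducible $\pi$ is square-integrable (a discrete series) if there is a non-zero $h \in \mathcal{H}_\pi$ with $\int_G |\langle h,\pi(x)h\rangle|^2\,d\mu(x) < \infty$, $\mu$ being Haar measure. For $\Gamma\subseteq G$, $\pi(\Gamma)g$ denotes the family $(\pi(\gamma)g)_{\gamma\in\Gamma}$; it is complete if its closed linear span is $\mathcal{H}_\pi$. For $S\subseteq\mathcal{H}_\pi$, $\operatorname{dist}(f,S)=\inf_{h\in S}\|f-h\|$. A family $(g_\gamma)_{\gamma\in\Gamma}$ in $\mathcal{H}_\pi$ satisfies the homogeneous approximation property if for every $f\in\mathcal{H}_\pi$ and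 every $\varepsilon>0$ there is a compact neighborhood $K$ of the identity of $G$ such that $\operatorname{dist}\big(\pi(x)f,\operatorname{span}\{g_\gamma : \gamma\in\Gamma\cap xK\}\big)<\varepsilon$ for all $x\in G$. *)

theory Defs
  imports "HOL-Analysis.Analysis" "HOL-Library.Set_Algebras"
begin

section \<open>Complex Hilbert spaces\<close>

text \<open>The inner product is linear in the first argument.\<close>

class complex_inner = real_normed_vector +
  fixes scaleC :: "complex \<Rightarrow> 'a \<Rightarrow> 'a" (infixr \<open>*\<^sub>C\<close> 75)
    and cinner :: "'a \<Rightarrow> 'a \<Rightarrow> complex"
  assumes scaleC_add_right: "a *\<^sub>C (x + y) = a *\<^sub>C x + a *\<^sub>C y"
    and scaleC_add_left: "(a + b) *\<^sub>C x = a *\<^sub>C x + b *\<^sub>C x"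
    and scaleC_scaleC: "a *\<^sub>C (b *\<^sub>C x) = (a * b) *\<^sub>C x"
    and scaleC_one: "1 *\<^sub>C x = x"
    and scaleR_scaleC: "r *\<^sub>R x = complex_of_real r *\<^sub>C x"
    and cinner_commute: "cinner x y = cnj (cinner y x)"
    and cinner_add_left: "cinner (x + y) z = cinner x z + cinner y z"
    and cinner_scaleC_left: "cinner (a *\<^sub>C x) y = a * cinner x y"
    and cinner_ge_zero: "0 \<le> Re (cinner x x)"
    and cinner_eq_zero_iff: "cinner x x = 0 \<longleftrightarrow> x = 0"
    and norm_eq_sqrt_cinner: "norm x = sqrt (Re (cinner x x))"

class chilbert_space = complex_inner + complete_space

interpretation complex_vector:
  vector_space "scaleC :: complex \<Rightarrow> 'a \<Rightarrow> 'a::complex_inner"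
  by unfold_locales (simp_all add: scaleC_add_right scaleC_add_left scaleC_scaleC scaleC_one)

instantiation complex :: chilbert_space
begin

definition scaleC_complex :: "complex \<Rightarrow> complex \<Rightarrow> complex"
  where "scaleC_complex a x = a * x"

definition cinner_complex :: "complex \<Rightarrow> complex \<Rightarrow> complex"
  where "cinner_complex x y = x * cnj y"

instance
proof
  fix x :: complex
  show "0 \<le> Re (cinner x x)"
    by (simp add: cinner_complex_def)
  show "norm x = sqrt (Re (cinner x x))"
    by (simp add: cinner_complex_def cmod_def power2_eq_square)
qed (simp_all add: scaleC_complex_def cinner_complex_def distrib_left distrib_right
      scaleR_conv_of_real mult.assoc)

end

definition unitary :: "('h::chilbert_space \<Rightarrow> 'h) \<Rightarrow> bool" where
  "unitary U \<longleftrightarrow> Vector_Spaces.linear scaleC scaleC U \<and> surj U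
     \<and> (\<forall>x y. cinner (U x) (U y) = cinner x y)"


section \<open>Haar measure, unimodularity, amenability\<close>

text \<open>
  Groups are written additively because \<^class>\<open>topological_group_add\<close> is the type class for
  topological groups. Commutativity is not assumed: the group product \<open>x y\<close> is
  \<open>x + y\<close>, the inverse is \<open>- x\<close> and the identity is \<open>0\<close>.
\<close>

definition left_haar_measure :: "'g::{topological_group_add, t2_space} measure \<Rightarrow> bool" where
  "left_haar_measure \<mu> \<longleftrightarrow>
     sets \<mu> = sets borel
   \<and> emeasure \<mu> UNIV \<noteq> 0
   \<and> (\<forall>K. compact K \<longrightarrow> emeasure \<mu> K < \<infinity>)
   \<and> (\<forall>A\<in>sets borel. emeasure \<mu> A = (INF U\<in>{U. open U \<and> A \<subseteq> U}. emeasure \<mu> U))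
   \<and> (\<forall>U. open U \<longrightarrow> emeasure \<mu> U = (SUP K\<in>{K. compact K \<and> K \<subseteq> U}. emeasure \<mu> K))
   \<and> (\<forall>a. \<forall>A\<in>sets borel. emeasure \<mu> (a +o A) = emeasure \<mu> A)"

definition unimodular :: "'g::{topological_group_add, t2_space} itself \<Rightarrow> bool" where
  "unimodular _ \<longleftrightarrow>
     (\<forall>\<mu>::'g measure. left_haar_measure \<mu> \<longrightarrow>
        (\<forall>a. \<forall>A\<in>sets borel. emeasure \<mu> ((\<lambda>x. x + a) ` A) = emeasure \<mu> A))"

definition essentially_bounded :: "'a measure \<Rightarrow> ('a \<Rightarrow> real) \<Rightarrow> bool" where
  "essentially_bounded \<mu> f \<longleftrightarrow> f \<in> borel_measurable \<mu> \<and> (\<exists>C. AE x in \<mu>. \<bar>f x\<bar> \<le> C)"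

text \<open>
  A left-invariant mean on \<open>L\<^sup>\<infinity>(\<mu>)\<close>, given on representatives. Linearity and positivity up
  to null sets force it to agree on functions that are equal almost everywhere.
\<close>

definition left_invariant_mean ::
    "'g::topological_group_add measure \<Rightarrow> (('g \<Rightarrow> real) \<Rightarrow> real) \<Rightarrow> bool" where
  "left_invariant_mean \<mu> m \<longleftrightarrow>
     (\<forall>f g. essentially_bounded \<mu> f \<longrightarrow> essentially_bounded \<mu> g \<longrightarrow>
        m (\<lambda>x. f x + g x) = m f + m g)
   \<and> (\<forall>f c. essentially_bounded \<mu> f \<longrightarrow> m (\<lambda>x. c * f x) = c * m f)
   \<and> (\<forall>f. essentially_bounded \<mu> f \<longrightarrow> (AE x in \<mu>. 0 \<le> f x) \<longrightarrow> 0 \<le> m f)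
   \<and> m (\<lambda>_. 1) = 1
   \<and> (\<forall>f a. essentially_bounded \<mu> f \<longrightarrow> m (\<lambda>x. f (- a + x)) = m f)"

definition amenable :: "'g::{topological_group_add, t2_space} itself \<Rightarrow> bool" where
  "amenable _ \<longleftrightarrow> (\<exists>(\<mu>::'g measure) m. left_haar_measure \<mu> \<and> left_invariant_mean \<mu> m)"

definition relatively_dense :: "'g::topological_group_add set \<Rightarrow> bool" where
  "relatively_dense \<Lambda> \<longleftrightarrow> (\<exists>K. compact K \<and> \<Lambda> + K = UNIV)"


section \<open>Projective unitary representations\<close>

definition two_cocycle :: "('g::topological_group_add \<Rightarrow> 'g \<Rightarrow> complex) \<Rightarrow> bool" where
  "two_cocycle \<sigma> \<longleftrightarrow> (\<forall>x y. cmod (\<sigma> x y) = 1)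
     \<and> (\<forall>x y z. \<sigma> x y * \<sigma> (x + y) z = \<sigma> x (y + z) * \<sigma> y z)"

definition projective_unitary_rep ::
    "('g::topological_group_add \<Rightarrow> 'h::chilbert_space \<Rightarrow> 'h) \<Rightarrow> bool" where
  "projective_unitary_rep \<pi> \<longleftrightarrow>
     (\<forall>x. unitary (\<pi> x))
   \<and> (\<forall>h. continuous_on UNIV (\<lambda>x. \<pi> x h))
   \<and> (\<exists>\<sigma>. two_cocycle \<sigma> \<and> (\<forall>x y h. \<pi> x (\<pi> y h) = \<sigma> x y *\<^sub>C \<pi> (x + y) h))"

definition irreducible_rep ::
    "('g \<Rightarrow> 'h::chilbert_space \<Rightarrow> 'h) \<Rightarrow> bool" where
  "irreducible_rep \<pi> \<longleftrightarrow>
     (\<forall>S. complex_vector.subspace S \<and> closed S \<and> (\<forall>x. \<pi> x ` S \<subseteq> S) \<longrightarrow> S = {0} \<or> S = UNIV)"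

definition square_integrable_rep ::
    "'g measure \<Rightarrow> ('g \<Rightarrow> 'h::chilbert_space \<Rightarrow> 'h) \<Rightarrow> bool" where
  "square_integrable_rep \<mu> \<pi> \<longleftrightarrow>
     (\<exists>h. h \<noteq> 0 \<and> (\<integral>\<^sup>+ x. ennreal ((cmod (cinner h (\<pi> x h)))\<^sup>2) \<partial>\<mu>) < \<infinity>)"

text \<open>A family \<open>(u \<gamma>)\<close>, \<open>\<gamma> \<in> \<Gamma>\<close>, is a function \<open>u\<close> together with its index set \<open>\<Gamma>\<close>.\<close>

definition complete_family :: "'g set \<Rightarrow> ('g \<Rightarrow> 'h::chilbert_space) \<Rightarrow> bool" where
  "complete_family \<Gamma> u \<longleftrightarrow> closure (complex_vector.span (u ` \<Gamma>)) = UNIV"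

definition homogeneous_approximation_property ::
    "('g::topological_group_add \<Rightarrow> 'h::chilbert_space \<Rightarrow> 'h) \<Rightarrow> 'g set \<Rightarrow> ('g \<Rightarrow> 'h) \<Rightarrow> bool" where
  "homogeneous_approximation_property \<pi> \<Gamma> u \<longleftrightarrow>
     (\<forall>f. \<forall>\<epsilon>>0. \<exists>K. compact K \<and> 0 \<in> interior K \<and>
        (\<forall>x. infdist (\<pi> x f) (complex_vector.span (u ` (\<Gamma> \<inter> (x +o K)))) < \<epsilon>))"

end

(*
  Let C be compact with \<Lambda> C = G. Completeness of \<pi>(\<Lambda>)g and compactness of \<pi>(C)f yield one finite
  set F of points of \<Lambda> such that every \<pi>(c)f, c in C, is \<epsilon>-close to span \<pi>(F)g. Write x = \<lambda>c:
  up to a scalar, the unitary \<pi>(\<lambda>) sends \<pi>(c)f to \<pi>(x)f and maps span \<pi>(F)g into span \<pi>(\<lambda>F)g,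
  where \<lambda>F = x c^{-1} F lies both in \<Lambda>^2 and in x C^{-1} F.
*)

theory Submission
  imports Defs
begin

lemma unitary_add: "unitary U \<Longrightarrow> U (x + y) = U x + U y"
  and unitary_scaleC: "unitary U \<Longrightarrow> U (a *\<^sub>C x) = a *\<^sub>C U x"
  unfolding unitary_def
  using Vector_Spaces.linear.axioms(3) module_hom.add module_hom.scale by blast+

lemma unitary_diff:
  assumes "unitary U"
  shows "U (x - y) = U x - U y"
  using unitary_add[OF assms, of "x - y" y] by simp

lemma norm_unitary: "unitary U \<Longrightarrow> norm (U x) = norm x"
  by (simp add: unitary_def norm_eq_sqrt_cinner)

lemma dist_unitary: "unitary U \<Longrightarrow> dist (U x) (U y) = dist x y"
  by (metis dist_norm norm_unitary unitary_diff)

text \<open>Generators need only land in the span of \<open>B'\<close>, not in \<open>B'\<close>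
  itself: a projective representation moves the orbit of \<open>g\<close> to itself only up to
  scalars.\<close>

lemma unitary_image_span_subset:
  assumes U: "unitary U"
    and B: "\<And>b. b \<in> B \<Longrightarrow> U b \<in> complex_vector.span B'"
    and v: "v \<in> complex_vector.span B"
  shows "U v \<in> complex_vector.span B'"
  using v
proof (induction rule: complex_vector.span_induct_alt)
  case base
  have "U 0 = 0"
    using unitary_diff[OF U, of 0 0] by simp
  then show ?case
    by (simp add: complex_vector.span_zero)
next
  case (step c x y)
  then show ?case
    by (simp add: unitary_add[OF U] unitary_scaleC[OF U] B complex_vector.span_add
        complex_vector.span_scale)
qed

text \<open>For non-real scalars homogeneity has to come from the inner product: \<open>a\<close>
  leaves the first slot by linearity and the second by conjugate symmetry.\<close>

lemma norm_scaleC: "norm (a *\<^sub>C x) = cmod a * norm (x :: 'a::complex_inner)"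
proof -
  have "cinner (a *\<^sub>C x) (a *\<^sub>C x) = a * cnj (a * cinner x x)"
    by (metis cinner_commute cinner_scaleC_left)
  also have "\<dots> = (a * cnj a) * cinner x x"
    by (simp add: cinner_commute[of x x, symmetric])
  also have "\<dots> = complex_of_real ((cmod a)\<^sup>2) * cinner x x"
    by (simp add: complex_norm_square del: of_real_power)
  finally have "Re (cinner (a *\<^sub>C x) (a *\<^sub>C x)) = (cmod a)\<^sup>2 * Re (cinner x x)"
    by simp
  then show ?thesis
    by (simp add: norm_eq_sqrt_cinner[of x] norm_eq_sqrt_cinner[of "a *\<^sub>C x"] real_sqrt_mult)
qed

text \<open>Nonemptiness of \<open>A\<close> matters because \<open>infdist x {}\<close> is 0 by
  convention.\<close>

lemma infdist_lessE:
  assumes "A \<noteq> {}" "infdist x A < e"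
  obtains a where "a \<in> A" "dist x a < e"
  using assms by (auto simp: infdist_def cINF_less_iff)

text \<open>For finite \<open>F\<close> inside \<Gamma>, the points where the span of
  \<open>F\<close> approximates well form an open set \<open>W F\<close>, increasing in
  \<open>F\<close>. Completeness makes these sets cover \<open>C\<close>, so a finite subcover
  exists, and the union of its index sets works on all of \<open>C\<close>.\<close>

lemma complete_family_uniformly_finite:
  fixes u :: "'a \<Rightarrow> 'h::chilbert_space" and \<phi> :: "'b::topological_space \<Rightarrow> 'h"
  assumes complete: "complete_family \<Gamma> u"
    and C: "compact C"
    and cont: "continuous_on UNIV \<phi>"
    and e: "\<epsilon> > 0"
  obtains F where "finite F" "F \<subseteq> \<Gamma>"
    "\<And>c. c \<in> C \<Longrightarrow> infdist (\<phi> c) (complex_vector.span (u ` F)) < \<epsilon>"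
proof -
  define W where "W F = {c. infdist (\<phi> c) (complex_vector.span (u ` F)) < \<epsilon>}" for F
  have W_mono: "W F \<subseteq> W F'" if "F \<subseteq> F'" for F F'
  proof -
    \<comment> \<open>A larger set is at smaller distance only if the smaller one is nonempty; the
      zero vector ensures this.\<close>
    have "infdist (\<phi> c) (complex_vector.span (u ` F')) 
        \<le> infdist (\<phi> c) (complex_vector.span (u ` F))" for c
      using complex_vector.span_zero
      by (intro infdist_mono complex_vector.span_mono image_mono that) blast
    then show ?thesis
      unfolding W_def by (auto intro: le_less_trans)
  qed
  have W_open: "open (W F)" for F
    unfolding W_def by (intro open_Collect_less continuous_intros cont)
  have "C \<subseteq> (\<Union>F\<in>{F. finite F \<and> F \<subseteq> \<Gamma>}. W F)"
  proof
    fix c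
    have "\<phi> c \<in> closure (complex_vector.span (u ` \<Gamma>))"
      using complete by (simp add: complete_family_def)
    then obtain v where v: "v \<in> complex_vector.span (u ` \<Gamma>)" "dist (\<phi> c) v < \<epsilon>"
      using e by (metis closure_approachable dist_commute)
    obtain T where T: "finite T" "T \<subseteq> u ` \<Gamma>" "v \<in> complex_vector.span T"
    proof -
      from v(1) obtain T r where "finite T" "T \<subseteq> u ` \<Gamma>" and v_eq: "v = (\<Sum>a\<in>T. r a *\<^sub>C a)"
        unfolding complex_vector.span_explicit by blast
      moreover have "v \<in> complex_vector.span T"
        unfolding v_eq by (intro complex_vector.span_sum complex_vector.span_scale
            complex_vector.span_base)
      ultimately show thesis
        using that by blast
    qed
    \<comment> \<open>The finite set \<open>T\<close> of vectors is pulled back to finitely many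
      indices, one choice for each vector, as \<open>u\<close> need not be injective.\<close>
    then obtain F where F: "finite F" "F \<subseteq> \<Gamma>" "T = u ` F"
      by (meson finite_subset_image)
    have "infdist (\<phi> c) (complex_vector.span (u ` F)) < \<epsilon>"
      using infdist_le[of v] T(3) v(2) F(3) by (meson le_less_trans)
    with F show "c \<in> (\<Union>F\<in>{F. finite F \<and> F \<subseteq> \<Gamma>}. W F)"
      by (auto simp: W_def)
  qed
  then obtain \<F> where \<F>: "\<F> \<subseteq> {F. finite F \<and> F \<subseteq> \<Gamma>}" "finite \<F>" "C \<subseteq> (\<Union>F\<in>\<F>. W F)"
    by (rule compactE_image[OF C W_open])
  have "finite (\<Union>\<F>)" "\<Union>\<F> \<subseteq> \<Gamma>"
    using \<F> by auto
  moreover have "C \<subseteq> W (\<Union>\<F>)"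
  proof
    fix c assume "c \<in> C"
    then obtain F where "F \<in> \<F>" "c \<in> W F"
      using \<F>(3) by blast
    then show "c \<in> W (\<Union>\<F>)"
      using W_mono[of F "\<Union>\<F>"] by blast
  qed
  ultimately show thesis
    by (intro that[of "\<Union>\<F>"]) (simp_all add: W_def subset_iff)
qed

lemma compact_set_plus:
  fixes A B :: "'a::topological_monoid_add set"
  assumes "compact A" "compact B"
  shows "compact (A + B)"
proof -
  have "compact ((\<lambda>p. fst p + snd p) ` (A \<times> B))"
    by (intro compact_continuous_image compact_Times assms continuous_intros)
  moreover have "(\<lambda>p. fst p + snd p) ` (A \<times> B) = A + B"
    by (force simp: set_plus_def)
  ultimately show ?thesis
    by simp
qed

theorem proposition3p3:
  fixes \<mu> :: "'g::{topological_group_add, t2_space, second_countable_topology} measure"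
    and \<pi> :: "'g \<Rightarrow> 'h::chilbert_space \<Rightarrow> 'h"
    and \<Lambda> :: "'g set"
    and g :: 'h
  assumes "locally compact (UNIV :: 'g set)"
    and "amenable TYPE('g)"
    and "unimodular TYPE('g)"
    and "left_haar_measure \<mu>"
    and "projective_unitary_rep \<pi>"
    and "irreducible_rep \<pi>"
    and "square_integrable_rep \<mu> \<pi>"
    and "relatively_dense \<Lambda>"
    and "complete_family \<Lambda> (\<lambda>\<gamma>. \<pi> \<gamma> g)"
  shows "homogeneous_approximation_property \<pi> (\<Lambda> + \<Lambda>) (\<lambda>\<gamma>. \<pi> \<gamma> g)"
  unfolding homogeneous_approximation_property_def
proof (intro allI impI)
  fix f :: 'h and \<epsilon> :: real
  assume e: "\<epsilon> > 0"
  obtain \<sigma> where unit: "\<And>x. unitary (\<pi> x)"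
    and cont: "\<And>h. continuous_on UNIV (\<lambda>x. \<pi> x h)"
    and \<sigma>: "\<And>x y. cmod (\<sigma> x y) = 1"
    and mult: "\<And>x y h. \<pi> x (\<pi> y h) = \<sigma> x y *\<^sub>C \<pi> (x + y) h"
    using assms(5) unfolding projective_unitary_rep_def two_cocycle_def by blast
  obtain C where C: "compact C" "\<Lambda> + C = UNIV"
    using assms(8) by (auto simp: relatively_dense_def)
  obtain F where F: "finite F" "F \<subseteq> \<Lambda>"
    and approx: "\<And>c. c \<in> C \<Longrightarrow>
      infdist (\<pi> c f) (complex_vector.span ((\<lambda>\<gamma>. \<pi> \<gamma> g) ` F)) < \<epsilon>"
    using complete_family_uniformly_finite[OF assms(9) C(1) cont e] by metis
  \<comment> \<open>Local compactness at the identity gives a compact neighbourhood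
    \<open>N\<close>.\<close>
  obtain V N :: "'g set" where V: "open V" "0 \<in> V" "V \<subseteq> N" "compact N"
    using assms(1)[unfolded locally_def, rule_format, of UNIV 0] by auto
  \<comment> \<open>The summand built from \<open>C\<close> and \<open>F\<close> contains every
    difference \<open>- c + \<phi>\<close> needed below, whatever \<open>x\<close> is;
    \<open>N\<close> is added to make \<open>K\<close> a neighbourhood of the identity.\<close>
  define K where "K = N \<union> (uminus ` C + F)"
  have "compact K"
    unfolding K_def
    by (intro compact_Un V(4) compact_set_plus compact_continuous_image C(1)
        finite_imp_compact F(1) continuous_intros)
  moreover have "0 \<in> interior K"
    using V by (auto simp: K_def interior_def)
  moreover have
    "infdist (\<pi> x f) (complex_vector.span ((\<lambda>\<gamma>. \<pi> \<gamma> g) ` ((\<Lambda> + \<Lambda>) \<inter> (x +o K)))) < \<epsilon>"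
    (is "infdist _ (complex_vector.span ?B) < \<epsilon>") for x
  proof -
    have "x \<in> \<Lambda> + C"
      by (simp add: C(2))
    then obtain l c where l: "l \<in> \<Lambda>" and c: "c \<in> C" and x: "x = l + c"
      by (auto elim: set_plus_elim)
    obtain v where v: "v \<in> complex_vector.span ((\<lambda>\<gamma>. \<pi> \<gamma> g) ` F)" "dist (\<pi> c f) v < \<epsilon>"
      using approx[OF c] complex_vector.span_zero by (metis empty_iff infdist_lessE)
    have shift: "l + \<phi> \<in> (\<Lambda> + \<Lambda>) \<inter> (x +o K)" if "\<phi> \<in> F" for \<phi>
    proof
      show "l + \<phi> \<in> \<Lambda> + \<Lambda>"
        using l that F(2) by blast
      \<comment> \<open>Since \<open>x = l + c\<close>, the term \<open>- c\<close> cancels on the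
        right of \<open>x\<close>, so this holds without commutativity.\<close>
      have "l + \<phi> = x + (- c + \<phi>)"
        by (simp add: x add.assoc)
      moreover have "- c + \<phi> \<in> K"
        using c that by (auto simp: K_def)
      ultimately show "l + \<phi> \<in> x +o K"
        by (metis set_plus_intro2)
    qed
    have "\<pi> l v \<in> complex_vector.span ?B"
    proof (rule unitary_image_span_subset[OF unit _ v(1)])
      fix b assume "b \<in> (\<lambda>\<gamma>. \<pi> \<gamma> g) ` F"
      then obtain \<phi> where \<phi>: "\<phi> \<in> F" "b = \<pi> \<phi> g"
        by blast
      then show "\<pi> l b \<in> complex_vector.span ?B"
        \<comment> \<open>The vector becomes \<open>\<sigma> l \<phi>\<close> times the generator
          indexed by \<open>l + \<phi>\<close>, and the span absorbs the scalar.\<close>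
        unfolding \<phi>(2) mult
        by (intro complex_vector.span_scale complex_vector.span_base imageI shift)
    qed
    \<comment> \<open>This is the approximant of \<open>\<pi> x f\<close>: the factor
      \<open>inverse (\<sigma> l c)\<close> undoes the cocycle in
      \<open>\<pi> l (\<pi> c f)\<close>. It has modulus one, so distances are unchanged.\<close>
    then have in_span: "inverse (\<sigma> l c) *\<^sub>C \<pi> l v \<in> complex_vector.span ?B"
      by (rule complex_vector.span_scale)
    have "\<sigma> l c \<noteq> 0"
      using \<sigma>[of l c] by auto
    then have "\<pi> x f = inverse (\<sigma> l c) *\<^sub>C \<pi> l (\<pi> c f)"
      by (simp add: mult x)
    then have "dist (\<pi> x f) (inverse (\<sigma> l c) *\<^sub>C \<pi> l v) = dist (\<pi> l (\<pi> c f)) (\<pi> l v)"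
      by (simp add: dist_norm norm_scaleC norm_inverse \<sigma>
          flip: complex_vector.scale_right_diff_distrib)
    also have "\<dots> < \<epsilon>"
      using v(2) by (simp add: dist_unitary unit)
    finally show ?thesis
      using infdist_le[OF in_span] by (meson le_less_trans)
  qed
  ultimately show "\<exists>K. compact K \<and> 0 \<in> interior K \<and> (\<forall>x. infdist (\<pi> x f)
      (complex_vector.span ((\<lambda>\<gamma>. \<pi> \<gamma> g) ` ((\<Lambda> + \<Lambda>) \<inter> (x +o K)))) < \<epsilon>)"
    by blast
qed

end
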